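(* Let $d\ge 3$, $\sigma>0$, $\mu_1,\mu_2\in\mathbb{R}$, and let $\epsilon,\epsilon_1,\dots,\epsilon_d$ be independent Gaussian random variables with mean $0$ and standard deviation $\sigma$. Let $X=(\mu_1+\epsilon_1+\epsilon,\ \mu_2+\epsilon_2+\epsilon,\ \epsilon_3,\dots,\epsilon_d)\in\mathbb{R}^d/\mathbb{R}{\bf 1}$, and let $X'\in\mathbb{R}^d/\mathbb{R}{\bf 1}$ be the projected point of $X$ onto the one-dimensional Stiefel tropical linear space $L(A_1)$ of the $2\times d$ matrix $$A_1=\begin{pmatrix}\mu_1&-\infty&0&\cdots&0\\-\infty&\mu_2&0&\cdots&0\end{pmatrix}.$$ Then $$d_{\rm tr}(X,X')=\max_{i=1,\dots,d}\{\epsilon_i+\epsilon\,\mathrm{I}_{i\le 2}-\epsilon^*\},$$ where $\mathrm{I}_{i\le 2}$ is $1$ if $i\le 2$ and $0$ otherwise, and $\epsilon^*$ is the second smallest value (counted with multiplicity) in $\{\epsilon_1+\epsilon,\ \epsilon_2+\epsilon,\ \epsilon_3,\dots,\epsilon_d\}$; and $$\mathbb{E}[d_{\rm tr}(X,X')]\le 3\sigma\sqrt{2\log(d)}.$$ Specifically, $\lim_{\sigma\to 0}\mathbb{E}[d_{\rm tr}(X,X')]=0$.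
   Context: ${\bf 1}=(1,\dots,1)$, $[d]=\{1,\dots,d\}$. Tropical distance: $d_{\rm tr}(v,w)=\max_i(v_i-w_i)-\min_i(v_i-w_i)$. The tropical determinant of a $q\times q$ matrix $B$ over $\mathbb{R}\cup\{-\infty\}$ is $\mathrm{tdet}(B)=\max_{\sigma\in S_q}\sum_{i}B_{i,\sigma(i)}$. For an $m\times d$ matrix $A$ with $m<d$, $p_A(\omega)=\mathrm{tdet}(A_\omega)$ for $m$-subsets $\omega\subseteq[d]$, where $A_\omega$ consists of the columns of $A$ indexed by $\omega$; these are the tropical Plücker coordinates. The Stiefel tropical linear space $L(A)$ is the set of $x\in(\mathbb{R}\cup\{-\infty\})^d/\mathbb{R}{\bf 1}$ such that for every $(m+1)$-subset $\tau\subseteq[d]$ the maximum of $p_A(\tau\setminus\{t\})+x_t$ over $t\in\tau$ is attained at least twice. The projected point of $u\in\mathbb{R}^d/\mathbb{R}{\bf 1}$ onto $L(A)$ is the point $w$ given by the Blue Rule: $w_i=\max_{\tau}\min_{j\notin\tau}\{u_j+p_A(\tau\cup\{i\})-p_A(\tau\cup\{j\})\}$, where $\tau$ runs over $(m-1)$-subsets of $[d]$ not containing $i$; it is a known fact that $w\in L(A)$ and $w$ minimizes $d_{\rm tr}(u,\cdot)$ over $L(A)$. *)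

theory Defs
  imports "HOL-Probability.Probability" "HOL-Combinatorics.Permutations"
begin

text \<open>
  Vectors and matrices are functions on natural numbers, only their values at the indices
  \<open>1, \<dots>, d\<close> being used.  Points of \<open>\<real>\<^sup>d / \<real>1\<close> are given by representatives; the lemmas
  \<open>trop_dist_shift_left\<close>, \<open>trop_dist_shift_right\<close> and \<open>blue_rule_shift\<close> show that
  nothing below depends on the choice.  Elements of \<open>\<real> \<union> {-\<infinity>}\<close> have type \<^typ>\<open>ereal\<close>.
\<close>

definition trop_dist :: "nat \<Rightarrow> (nat \<Rightarrow> real) \<Rightarrow> (nat \<Rightarrow> real) \<Rightarrow> real" where
  "trop_dist d v w = (MAX i\<in>{1..d}. v i - w i) - (MIN i\<in>{1..d}. v i - w i)"

definition tdet :: "nat \<Rightarrow> (nat \<Rightarrow> nat \<Rightarrow> ereal) \<Rightarrow> ereal" where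
  "tdet q B = (MAX \<sigma>\<in>{\<sigma>. \<sigma> permutes {1..q}}. \<Sum>i\<in>{1..q}. B i (\<sigma> i))"

definition column_submatrix :: "(nat \<Rightarrow> nat \<Rightarrow> ereal) \<Rightarrow> nat set \<Rightarrow> nat \<Rightarrow> nat \<Rightarrow> ereal" where
  "column_submatrix A \<omega> i j = A i (sorted_list_of_set \<omega> ! (j - 1))"

definition tpluecker :: "nat \<Rightarrow> (nat \<Rightarrow> nat \<Rightarrow> ereal) \<Rightarrow> nat set \<Rightarrow> ereal" where
  "tpluecker m A \<omega> = tdet m (column_submatrix A \<omega>)"

definition stiefel_tls :: "nat \<Rightarrow> nat \<Rightarrow> (nat \<Rightarrow> nat \<Rightarrow> ereal) \<Rightarrow> (nat \<Rightarrow> ereal) set" where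
  "stiefel_tls m d A = {x. (\<forall>i\<in>{1..d}. x i \<noteq> \<infinity>) \<and>
     (\<forall>\<tau>. \<tau> \<subseteq> {1..d} \<and> card \<tau> = m + 1 \<longrightarrow>
       (\<exists>s\<in>\<tau>. \<exists>t\<in>\<tau>. s \<noteq> t \<and>
          (\<forall>r\<in>\<tau>. tpluecker m A (\<tau> - {r}) + x r \<le> tpluecker m A (\<tau> - {s}) + x s) \<and>
          (\<forall>r\<in>\<tau>. tpluecker m A (\<tau> - {r}) + x r \<le> tpluecker m A (\<tau> - {t}) + x t)))}"

text \<open>
  A term whose subtrahend alone is \<open>-\<infinity>\<close> equals \<open>\<infinity>\<close> and so does not affect
  the minimum.  When all tropical Pluecker coordinates are finite, as for the matrix
  \<open>line_matrix\<close> below, no infinite value occurs at all.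
\<close>

definition blue_rule ::
    "nat \<Rightarrow> nat \<Rightarrow> (nat \<Rightarrow> nat \<Rightarrow> ereal) \<Rightarrow> (nat \<Rightarrow> real) \<Rightarrow> nat \<Rightarrow> ereal" where
  "blue_rule m d A u i =
     (MAX \<tau>\<in>{\<tau>. \<tau> \<subseteq> {1..d} \<and> card \<tau> = m - 1 \<and> i \<notin> \<tau>}.
       MIN j\<in>{1..d} - \<tau>.
         ereal (u j) + tpluecker m A (\<tau> \<union> {i}) - tpluecker m A (\<tau> \<union> {j}))"

definition projected_point ::
    "nat \<Rightarrow> nat \<Rightarrow> (nat \<Rightarrow> nat \<Rightarrow> ereal) \<Rightarrow> (nat \<Rightarrow> real) \<Rightarrow> nat \<Rightarrow> real" where
  "projected_point m d A u i = real_of_ereal (blue_rule m d A u i)"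

definition line_matrix :: "real \<Rightarrow> real \<Rightarrow> nat \<Rightarrow> nat \<Rightarrow> ereal" where
  "line_matrix \<mu>1 \<mu>2 i j =
     (if j = 1 then (if i = 1 then ereal \<mu>1 else - \<infinity>)
      else if j = 2 then (if i = 2 then ereal \<mu>2 else - \<infinity>)
      else 0)"

text \<open>
  The common error \<open>\<epsilon>\<close> is \<open>e0\<close>, the error \<open>\<epsilon>\<^sub>i\<close> is \<open>e i\<close> for \<open>1 \<le> i \<le> d\<close>; for joint
  independence the former is put at the index \<open>0\<close>.
\<close>

definition gaussian_noise ::
    "nat \<Rightarrow> real \<Rightarrow> 'a measure \<Rightarrow> ('a \<Rightarrow> real) \<Rightarrow> (nat \<Rightarrow> 'a \<Rightarrow> real) \<Rightarrow> bool" where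
  "gaussian_noise d \<sigma> M e0 e \<longleftrightarrow>
     prob_space M \<and>
     prob_space.indep_vars M (\<lambda>_. borel) (e(0 := e0)) {0..d} \<and>
     distributed M lborel e0 (normal_density 0 \<sigma>) \<and>
     (\<forall>i\<in>{1..d}. distributed M lborel (e i) (normal_density 0 \<sigma>))"

definition sample_point ::
    "real \<Rightarrow> real \<Rightarrow> ('a \<Rightarrow> real) \<Rightarrow> (nat \<Rightarrow> 'a \<Rightarrow> real) \<Rightarrow> 'a \<Rightarrow> nat \<Rightarrow> real" where
  "sample_point \<mu>1 \<mu>2 e0 e \<omega> i =
     (if i = 1 then \<mu>1 + e 1 \<omega> + e0 \<omega>
      else if i = 2 then \<mu>2 + e 2 \<omega> + e0 \<omega>
      else e i \<omega>)"

definition second_smallest :: "nat \<Rightarrow> (nat \<Rightarrow> real) \<Rightarrow> real" where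
  "second_smallest d y = sort (map y [1..<d + 1]) ! 1"

definition proj_dist ::
    "nat \<Rightarrow> real \<Rightarrow> real \<Rightarrow> ('a \<Rightarrow> real) \<Rightarrow> (nat \<Rightarrow> 'a \<Rightarrow> real) \<Rightarrow> 'a \<Rightarrow> real" where
  "proj_dist d \<mu>1 \<mu>2 e0 e \<omega> =
     trop_dist d (sample_point \<mu>1 \<mu>2 e0 e \<omega>)
       (projected_point 2 d (line_matrix \<mu>1 \<mu>2) (sample_point \<mu>1 \<mu>2 e0 e \<omega>))"

lemma Max_shift:
  fixes f :: "'b \<Rightarrow> real"
  assumes "finite S" "S \<noteq> {}"
  shows "(MAX i\<in>S. f i + c) = (MAX i\<in>S. f i) + c"
  using mono_Max_commute[of "\<lambda>x. x + c" "f ` S"] assms by (simp add: mono_def image_image)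

lemma Min_shift:
  fixes f :: "'b \<Rightarrow> real"
  assumes "finite S" "S \<noteq> {}"
  shows "(MIN i\<in>S. f i + c) = (MIN i\<in>S. f i) + c"
  using mono_Min_commute[of "\<lambda>x. x + c" "f ` S"] assms by (simp add: mono_def image_image)

lemma trop_dist_shift_left:
  assumes "d \<ge> 1"
  shows "trop_dist d (\<lambda>i. v i + c) w = trop_dist d v w"
proof -
  have *: "\<And>i. v i + c - w i = (v i - w i) + c" by simp
  show ?thesis unfolding trop_dist_def *
    using assms by (subst Max_shift, simp, simp, subst Min_shift) auto
qed

lemma trop_dist_shift_right:
  assumes "d \<ge> 1"
  shows "trop_dist d v (\<lambda>i. w i + c) = trop_dist d v w"
proof -
  have *: "\<And>i. v i - (w i + c) = (v i - w i) + (- c)" by simp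
  show ?thesis unfolding trop_dist_def *
    using assms by (subst Max_shift, simp, simp, subst Min_shift) auto
qed

lemma blue_rule_shift:
  assumes "1 \<le> m" "m < d" "i \<in> {1..d}"
  shows "blue_rule m d A (\<lambda>j. u j + c) i = blue_rule m d A u i + ereal c"
proof -
  let ?T = "{\<tau>. \<tau> \<subseteq> {1..d} \<and> card \<tau> = m - 1 \<and> i \<notin> \<tau>}"
  let ?f = "\<lambda>\<tau> j. ereal (u j) + tpluecker m A (\<tau> \<union> {i}) - tpluecker m A (\<tau> \<union> {j})"
  have mon: "mono (\<lambda>x. x + ereal c)" by (auto simp: mono_def intro: add_right_mono)
  have fin: "finite ?T" by (rule finite_subset[of _ "Pow {1..d}"]) auto
  have "m - 1 \<le> card ({1..d} - {i})" using assms by simp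
  then obtain T where "T \<subseteq> {1..d} - {i}" "card T = m - 1" by (metis obtain_subset_with_card_n)
  then have ne: "?T \<noteq> {}" by blast
  have shift: "ereal (u j + c) + a - b = (ereal (u j) + a - b) + ereal c" for a b j
    by (cases a; cases b) auto
  have inner: "(MIN j\<in>{1..d} - \<tau>. ?f \<tau> j + ereal c) = (MIN j\<in>{1..d} - \<tau>. ?f \<tau> j) + ereal c"
    if "\<tau> \<in> ?T" for \<tau>
  proof -
    have "{1..d} - \<tau> \<noteq> {}" using that assms(3) by blast
    then show ?thesis
      using mono_Min_commute[OF mon, of "?f \<tau> ` ({1..d} - \<tau>)"] by (simp add: image_image)
  qed
  have "blue_rule m d A (\<lambda>j. u j + c) i = (MAX \<tau>\<in>?T. (MIN j\<in>{1..d} - \<tau>. ?f \<tau> j) + ereal c)"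
    unfolding blue_rule_def shift by (intro arg_cong[of _ _ Max] image_cong refl inner)
  also have "\<dots> = blue_rule m d A u i + ereal c"
    unfolding blue_rule_def
    using mono_Max_commute[OF mon, of "(\<lambda>\<tau>. MIN j\<in>{1..d} - \<tau>. ?f \<tau> j) ` ?T"] fin ne
    by (simp add: image_image)
  finally show ?thesis .
qed

definition line_offset :: "real \<Rightarrow> real \<Rightarrow> nat \<Rightarrow> real" where
  "line_offset \<mu>1 \<mu>2 k = (if k = 1 then \<mu>1 else if k = 2 then \<mu>2 else 0)"
lemma permutes_two: "{\<sigma>. \<sigma> permutes {1..2::nat}} = {id, Transposition.transpose 1 2}"
proof -
  have "{1..2::nat} = {1,2}" by auto
  then show ?thesis
    by (auto simp: permutes_doubleton_iff)
qed

lemma tpluecker_line_matrix_less: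
  assumes "1 \<le> a" "a < b"
  shows "tpluecker 2 (line_matrix \<mu>1 \<mu>2) {a, b} = ereal (line_offset \<mu>1 \<mu>2 a + line_offset \<mu>1 \<mu>2 b)"
proof -
  have l: "sorted_list_of_set {a, b} = [a, b]"
    using assms(2) by (auto simp: insort_is_Cons sorted_list_of_set_insert)
  have "{1..2::nat} = {1,2}" by auto
  then have sum12: "sum f {Suc 0..2::nat} = f 1 + f 2" for f :: "nat \<Rightarrow> ereal" by simp
  show ?thesis
    using assms unfolding tpluecker_def tdet_def permutes_two column_submatrix_def l line_matrix_def line_offset_def
    by (auto simp: sum12 zero_ereal_def Transposition.transpose_def)
qed

lemma tpluecker_line_matrix:
  assumes "a \<ge> 1" "b \<ge> 1" "a \<noteq> b"
  shows "tpluecker 2 (line_matrix \<mu>1 \<mu>2) {a, b} = ereal (line_offset \<mu>1 \<mu>2 a + line_offset \<mu>1 \<mu>2 b)"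
  using tpluecker_line_matrix_less[of a b \<mu>1 \<mu>2] tpluecker_line_matrix_less[of b a \<mu>1 \<mu>2] assms
  by (cases "a<b") (auto simp: line_offset_def insert_commute add.commute)

lemma blue_rule_line_matrix:
  assumes "d \<ge> 3" "i \<in> {1..d}"
  shows "blue_rule 2 d (line_matrix \<mu>1 \<mu>2) u i =
    ereal (line_offset \<mu>1 \<mu>2 i + (MAX t\<in>{1..d}-{i}. MIN j\<in>{1..d}-{t}. u j - line_offset \<mu>1 \<mu>2 j))"
proof -
  let ?n = "line_offset \<mu>1 \<mu>2"
  have T: "{\<tau>. \<tau> \<subseteq> {1..d} \<and> card \<tau> = 2 - 1 \<and> i \<notin> \<tau>} = (\<lambda>t. {t}) ` ({1..d}-{i})"
    by (auto simp: card_1_singleton_iff)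
  have me: "mono ereal" by (auto simp: mono_def)
  have ne: "{1..d}-{t} \<noteq> {}" for t :: nat
  proof -
    have "(if t = 1 then 2 else 1) \<in> {1..d} - {t}" using assms(1) by auto
    then show ?thesis by blast
  qed
  have "blue_rule 2 d (line_matrix \<mu>1 \<mu>2) u i = (MAX t\<in>{1..d}-{i}. MIN j\<in>{1..d}-{t}.
     ereal (u j - ?n j + ?n i))"
    unfolding blue_rule_def T image_image
  proof (intro arg_cong[of _ _ Max] arg_cong[of _ _ Min] image_cong refl)
    fix t j assume "t \<in> {1..d}-{i}" "j \<in> {1..d}-{t}"
    then show "ereal (u j) + tpluecker 2 (line_matrix \<mu>1 \<mu>2) ({t} \<union> {i}) - tpluecker 2 (line_matrix \<mu>1 \<mu>2) ({t} \<union> {j})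
      = ereal (u j - ?n j + ?n i)"
      using assms(2) tpluecker_line_matrix[of t i \<mu>1 \<mu>2] tpluecker_line_matrix[of t j \<mu>1 \<mu>2] by (auto simp: insert_commute)
  qed
  also have "\<dots> = (MAX t\<in>{1..d}-{i}. ereal ((MIN j\<in>{1..d}-{t}. u j - ?n j) + ?n i))"
    using mono_Min_commute[OF me, of "(\<lambda>j. u j - ?n j + ?n i) ` ({1..d}-{t})" for t] ne
    by (intro arg_cong[of _ _ Max] image_cong refl) (simp add: image_image Min_shift)
  also have "\<dots> = ereal ((MAX t\<in>{1..d}-{i}. MIN j\<in>{1..d}-{t}. u j - ?n j) + ?n i)"
    using mono_Max_commute[OF me, of "(\<lambda>t. (MIN j\<in>{1..d}-{t}. u j - ?n j) + ?n i) ` ({1..d}-{i})"] ne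
    by (simp add: image_image Max_shift)
  finally show ?thesis by (simp add: add.commute)
qed

text \<open>The projected point is real and lies on the tropical line.\<close>

lemma projected_point_in_stiefel_tls:
  assumes "d \<ge> 3"
  shows "(\<lambda>i. ereal (projected_point 2 d (line_matrix \<mu>1 \<mu>2) u i)) \<in> stiefel_tls 2 d (line_matrix \<mu>1 \<mu>2)"
proof -
  let ?n = "line_offset \<mu>1 \<mu>2"
  let ?g = "\<lambda>t. MIN j\<in>{1..d}-{t}. u j - ?n j"
  let ?h = "\<lambda>i. MAX t\<in>{1..d}-{i}. ?g t"
  let ?x = "\<lambda>i. ereal (projected_point 2 d (line_matrix \<mu>1 \<mu>2) u i)"
  let ?c = "Max (?g ` {1..d})"
  have x: "?x i = ereal (?n i + ?h i)" if "i \<in> {1..d}" for i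
    using blue_rule_line_matrix[OF assms that] by (simp add: projected_point_def)
  have "?c \<in> ?g ` {1..d}" using assms by (intro Max_in) auto
  have ex: "\<exists>a\<in>{1..d}. ?g a = ?c"
    using \<open>?c \<in> ?g ` {1..d}\<close> by (metis (mono_tags, lifting) imageE)
  then obtain a where a: "a \<in> {1..d}" "?g a = ?c" by blast
  have le: "?h i \<le> ?c" if "i \<in> {1..d}" for i
  proof -
    have "{1..d} - {i} \<noteq> {}" 
    proof -
      have "(if i = 1 then 2 else 1) \<in> {1..d} - {i}" using assms by auto
      then show ?thesis by blast
    qed
    then show ?thesis by (intro Max_mono) auto
  qed
  have eq: "?h i = ?c" if "i \<in> {1..d}" "i \<noteq> a" for i
  proof (rule antisym[OF le[OF that(1)]])
    show "?c \<le> ?h i" unfolding a(2)[symmetric] using a(1) that by (intro Max_ge) auto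
  qed
  show ?thesis unfolding stiefel_tls_def
  proof (intro CollectI conjI ballI allI impI)
    fix \<tau> assume t: "\<tau> \<subseteq> {1..d} \<and> card \<tau> = 2 + 1"
    then have fin: "finite \<tau>" using finite_subset by blast
    have val: "tpluecker 2 (line_matrix \<mu>1 \<mu>2) (\<tau> - {r}) + ?x r = ereal (sum ?n \<tau> + ?h r)" if "r \<in> \<tau>" for r
    proof -
      have "card (\<tau> - {r}) = 2" using that t fin by simp
      then obtain p q where pq: "\<tau> - {r} = {p, q}" "p \<noteq> q" by (meson card_2_iff)
      have "p \<in> {1..d}" "q \<in> {1..d}" "r \<in> {1..d}" using pq t that by auto
      moreover have "sum ?n \<tau> = ?n r + sum ?n {p,q}" using sum.remove[OF fin that, of ?n] pq by simp
      ultimately show ?thesis using pq by (simp add: tpluecker_line_matrix x[of r])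
    qed
    have "card (\<tau> - {a}) \<ge> 2" using t fin by (simp add: card_Diff_singleton_if)
    then obtain S where "S \<subseteq> \<tau> - {a}" "card S = 2" by (meson obtain_subset_with_card_n)
    then obtain p q where pq: "p \<in> \<tau>" "q \<in> \<tau>" "p \<noteq> q" "p \<noteq> a" "q \<noteq> a" by (auto simp: card_2_iff)
    show "\<exists>s\<in>\<tau>. \<exists>t\<in>\<tau>. s \<noteq> t \<and>
          (\<forall>r\<in>\<tau>. tpluecker 2 (line_matrix \<mu>1 \<mu>2) (\<tau> - {r}) + ?x r \<le> tpluecker 2 (line_matrix \<mu>1 \<mu>2) (\<tau> - {s}) + ?x s) \<and>
          (\<forall>r\<in>\<tau>. tpluecker 2 (line_matrix \<mu>1 \<mu>2) (\<tau> - {r}) + ?x r \<le> tpluecker 2 (line_matrix \<mu>1 \<mu>2) (\<tau> - {t}) + ?x t)"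
    proof (rule bexI[OF _ pq(1)], rule bexI[OF _ pq(2)], intro conjI ballI)
      fix r assume r: "r \<in> \<tau>"
      have *: "r \<in> {1..d}" "p \<in> {1..d}" "q \<in> {1..d}" using t r pq by blast+
      have "?h r \<le> ?h p" "?h r \<le> ?h q"
        unfolding eq[OF *(2) pq(4)] eq[OF *(3) pq(5)] by (rule le[OF *(1)])+
      then show "tpluecker 2 (line_matrix \<mu>1 \<mu>2) (\<tau> - {r}) + ?x r \<le> tpluecker 2 (line_matrix \<mu>1 \<mu>2) (\<tau> - {p}) + ?x p"
        "tpluecker 2 (line_matrix \<mu>1 \<mu>2) (\<tau> - {r}) + ?x r \<le> tpluecker 2 (line_matrix \<mu>1 \<mu>2) (\<tau> - {q}) + ?x q"
        unfolding val[OF r] val[OF pq(1)] val[OF pq(2)] by simp_all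
    qed (rule pq(3))
  qed simp
qed

end

theory Submission
  imports Defs
begin

text \<open>
  Write \<open>y i = u i - line_offset \<mu>1 \<mu>2 i\<close>. On the tropical line all Pluecker coordinates are
  sums of two offsets, so in the coordinates \<open>y\<close> the Blue Rule only takes maxima of the numbers
  \<open>min_without d y t\<close>, the minimum of all entries except the one at \<open>t\<close>. Leaving out a
  minimizer \<open>a\<close> gives the second smallest value \<open>s\<close>; leaving out any other index gives \<open>y a\<close>.
  Hence projecting moves every coordinate to \<open>s\<close>, except that the one at \<open>a\<close> stays at \<open>y a\<close>.
  The differences between the point and its projection are \<open>y i - s\<close> for \<open>i \<noteq> a\<close>, with minimum
  \<open>0\<close>, and \<open>0\<close> at \<open>a\<close>, so the tropical distance is the maximum of \<open>y\<close> minus \<open>s\<close>; this is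
  \<open>trop_dist_projected_point\<close>. For the sample point the offsets cancel the means, which leaves
  the errors \<open>y i = \<epsilon>\<^sub>i + \<epsilon> I\<^sub>i\<close>, where \<open>I\<^sub>i\<close> is \<open>1\<close> for \<open>i \<le> 2\<close> and \<open>0\<close> otherwise.

  For the expectation the distance is at most the range of \<open>y\<close>, which is at most
  \<open>max \<epsilon>\<^sub>i + max (- \<epsilon>\<^sub>i) + \<bar>\<epsilon>\<bar>\<close>. Each summand is a maximum of at most \<open>d\<close> centred normal
  variables with standard deviation \<open>\<sigma>\<close> (the last one of \<open>\<epsilon>\<close> and \<open>- \<epsilon>\<close>), so the classical
  bound \<open>expectation_Max_normal_le\<close> gives \<open>\<sigma> sqrt (2 ln d)\<close> three times. That bound
  comes from the moment generating function and the fact that the exponential of a maximum is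
  at most the sum of the exponentials. As the distance is nonnegative, the limit follows by
  squeezing.
\<close>

section \<open>Order statistics\<close>

definition min_without :: "nat \<Rightarrow> (nat \<Rightarrow> real) \<Rightarrow> nat \<Rightarrow> real" where
  "min_without d y t = (MIN j\<in>{1..d} - {t}. y j)"

lemma exists_minimizer:
  fixes y :: "nat \<Rightarrow> real"
  assumes "d \<ge> 1"
  obtains a where "a \<in> {1..d}" "\<And>j. j \<in> {1..d} \<Longrightarrow> y a \<le> y j"
proof -
  have "Min (y ` {1..d}) \<in> y ` {1..d}"
    using assms by (intro Min_in) auto
  then obtain a where a: "a \<in> {1..d}" "Min (y ` {1..d}) = y a"
    by blast
  have "y a \<le> y j" if "j \<in> {1..d}" for j
    unfolding a(2)[symmetric] using that by (intro Min_le) auto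
  with a(1) show thesis by (rule that)
qed

lemma index_without_nonempty:
  fixes d t :: nat
  assumes "d \<ge> 2"
  shows "{1..d} - {t} \<noteq> {}"
proof -
  have "(if t = 1 then 2 else 1) \<in> {1..d} - {t}" using assms by auto
  then show ?thesis by blast
qed

lemma min_without_le:
  assumes "j \<in> {1..d}" "j \<noteq> t"
  shows "min_without d y t \<le> y j"
  unfolding min_without_def using assms by (intro Min_le) auto

lemma min_without_attained:
  assumes "d \<ge> 2"
  obtains b where "b \<in> {1..d}" "b \<noteq> t" "min_without d y t = y b"
proof -
  have "min_without d y t \<in> y ` ({1..d} - {t})"
    unfolding min_without_def using index_without_nonempty[OF assms] by (intro Min_in) auto
  then show thesis using that by blast
qed

lemma min_without_other:
  assumes "a \<in> {1..d}" "\<And>j. j \<in> {1..d} \<Longrightarrow> y a \<le> y j" "t \<noteq> a"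
  shows "min_without d y t = y a"
  unfolding min_without_def using assms by (intro Min_eqI) auto

text \<open>
  Sorting puts a minimizer first and then the sorted remaining values, whose head is their
  minimum. If the minimum is attained twice, both sides equal it.
\<close>

lemma second_smallest_eq_min_without:
  assumes "d \<ge> 2" and a: "a \<in> {1..d}" "\<And>j. j \<in> {1..d} \<Longrightarrow> y a \<le> y j"
  shows "second_smallest d y = min_without d y a"
proof -
  define ws where "ws = sort (map y (remove1 a [1..<d + 1]))"
  have sorted_ws: "sorted ws"
    by (simp add: ws_def)
  have set_ws: "set ws = y ` ({1..d} - {a})"
    by (auto simp: ws_def)
  have "mset [1..<d + 1] = add_mset a (mset (remove1 a [1..<d + 1]))"
    unfolding mset_remove1 using a(1) by (intro insert_DiffM[symmetric]) auto
  then have "mset (y a # ws) = mset (map y [1..<d + 1])"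
    by (metis image_mset_add_mset mset.simps(2) mset_map mset_sort ws_def)
  moreover have "sorted (y a # ws)"
    using a(2) set_ws sorted_ws by auto
  ultimately have "sort (map y [1..<d + 1]) = y a # ws"
    by (rule properties_for_sort)
  then have "second_smallest d y = ws ! 0"
    by (simp add: second_smallest_def)
  moreover obtain w ws' where w: "ws = w # ws'"
    using set_ws index_without_nonempty[OF assms(1)] by (cases ws) auto
  moreover have "Min (set ws) = w"
    using w sorted_ws by (intro Min_eqI) auto
  ultimately show ?thesis
    unfolding min_without_def set_ws[symmetric] by simp
qed

text \<open>
  A max-min formula without any reference to sorting, which makes the second smallest value
  of random variables visibly measurable.
\<close>

lemma second_smallest_eq_Max_min_without:
  assumes "d \<ge> 2"
  shows "second_smallest d y = (MAX t\<in>{1..d}. min_without d y t)"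
proof -
  have "d \<ge> 1" using assms by simp
  then obtain a where a: "a \<in> {1..d}" "\<And>j. j \<in> {1..d} \<Longrightarrow> y a \<le> y j"
    using exists_minimizer[of d y] by blast
  obtain b where b: "b \<in> {1..d}" "min_without d y a = y b"
    using min_without_attained[OF assms] by metis
  have "min_without d y t \<le> min_without d y a" if "t \<in> {1..d}" for t
    using min_without_other[of a d y t] a b by (cases "t = a") auto
  then have "(MAX t\<in>{1..d}. min_without d y t) = min_without d y a"
    using a(1) by (intro Max_eqI) auto
  then show ?thesis
    using second_smallest_eq_min_without[of d a y, OF assms a] by simp
qed

lemma second_smallest_cong:
  assumes "\<And>i. i \<in> {1..d} \<Longrightarrow> y i = z i"
  shows "second_smallest d y = second_smallest d z"
proof -
  have "map y [1..<d + 1] = map z [1..<d + 1]"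
    using assms by (intro map_cong) auto
  then show ?thesis by (simp only: second_smallest_def)
qed

section \<open>The distance to the projected point\<close>

lemma projected_point_line_matrix:
  fixes u :: "nat \<Rightarrow> real" and \<mu>1 \<mu>2 :: real
  defines "y \<equiv> \<lambda>i. u i - line_offset \<mu>1 \<mu>2 i"
  assumes "d \<ge> 3" and a: "a \<in> {1..d}" "\<And>j. j \<in> {1..d} \<Longrightarrow> y a \<le> y j" and i: "i \<in> {1..d}"
  shows "projected_point 2 d (line_matrix \<mu>1 \<mu>2) u i =
    line_offset \<mu>1 \<mu>2 i + (if i = a then y a else second_smallest d y)"
proof -
  have d2: "d \<ge> 2" using assms(2) by simp
  have s: "min_without d y a = second_smallest d y"
    using second_smallest_eq_min_without[of d a y, OF d2 a] by simp
  have other: "min_without d y t = y a" if "t \<noteq> a" for t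
    using min_without_other[of a d y t] a that by blast
  obtain b where b: "b \<in> {1..d}" "min_without d y a = y b"
    using min_without_attained[OF d2] by metis
  have "(MAX t\<in>{1..d} - {i}. min_without d y t) = (if i = a then y a else second_smallest d y)"
  proof (cases "i = a")
    case True
    have "min_without d y ` ({1..d} - {i}) = {y a}"
      using other index_without_nonempty[OF d2, of i] True by force
    then show ?thesis using True by simp
  next
    case False
    have "min_without d y t \<le> min_without d y a" for t
      using other[of t] a(2)[OF b(1)] b(2) by (cases "t = a") auto
    then have "(MAX t\<in>{1..d} - {i}. min_without d y t) = min_without d y a"
      using a(1) False by (intro Max_eqI) auto
    then show ?thesis using False s by simp
  qed
  then show ?thesis
    using blue_rule_line_matrix[OF assms(2) i, of \<mu>1 \<mu>2 u]
    by (simp add: projected_point_def min_without_def y_def)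
qed

lemma trop_dist_projected_point:
  fixes u :: "nat \<Rightarrow> real" and \<mu>1 \<mu>2 :: real
  defines "y \<equiv> \<lambda>i. u i - line_offset \<mu>1 \<mu>2 i"
  assumes "d \<ge> 3"
  shows "trop_dist d u (projected_point 2 d (line_matrix \<mu>1 \<mu>2) u) =
    (MAX i\<in>{1..d}. y i - second_smallest d y)"
proof -
  define s where "s = second_smallest d y"
  define D where "D i = u i - projected_point 2 d (line_matrix \<mu>1 \<mu>2) u i" for i
  have d2: "d \<ge> 2" and d1: "d \<ge> 1" using assms(2) by simp_all
  obtain a where a: "a \<in> {1..d}" "\<And>j. j \<in> {1..d} \<Longrightarrow> y a \<le> y j"
    using exists_minimizer[OF d1, of y] by blast
  have s: "s = min_without d y a"
    using second_smallest_eq_min_without[of d a y, OF d2 a] by (simp add: s_def)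
  obtain b where b: "b \<in> {1..d}" "b \<noteq> a" "s = y b"
    using min_without_attained[OF d2] s by metis
  have D: "D i = (if i = a then 0 else y i - s)" if "i \<in> {1..d}" for i
    using projected_point_line_matrix[of d a u \<mu>1 \<mu>2 i, folded y_def] assms(2) a that
    by (auto simp: D_def s_def y_def)
  have nonneg: "0 \<le> D i" if "i \<in> {1..d}" for i
    using D[OF that] min_without_le[OF that, of a y] s by auto
  have "(MIN i\<in>{1..d}. D i) = 0"
    using nonneg D[OF a(1)] a(1) by (intro Min_eqI) (auto simp: image_iff intro!: bexI[of _ a])
  moreover have "(MAX i\<in>{1..d}. D i) = (MAX i\<in>{1..d}. y i - s)"
  proof (rule antisym)
    have zero: "0 \<le> (MAX i\<in>{1..d}. y i - s)"
      using b by (intro Max_ge) (auto simp: image_iff intro!: bexI[of _ b])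
    have "D i \<le> (MAX i\<in>{1..d}. y i - s)" if "i \<in> {1..d}" for i
    proof (cases "i = a")
      case False
      then show ?thesis unfolding D[OF that] using that by (auto intro!: Max_ge)
    qed (use D[OF that] zero in simp)
    then show "(MAX i\<in>{1..d}. D i) \<le> (MAX i\<in>{1..d}. y i - s)"
      using d1 by (subst Max_le_iff) auto
    have "y i - s \<le> D i" if "i \<in> {1..d}" for i
      using D[OF that] a(2)[OF b(1)] b(3) by auto
    moreover have "D i \<le> (MAX i\<in>{1..d}. D i)" if "i \<in> {1..d}" for i
      using that by (intro Max_ge) auto
    ultimately have "y i - s \<le> (MAX i\<in>{1..d}. D i)" if "i \<in> {1..d}" for i
      using that by (meson order_trans)
    then show "(MAX i\<in>{1..d}. y i - s) \<le> (MAX i\<in>{1..d}. D i)"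
      using d1 by (subst Max_le_iff) auto
  qed
  ultimately show ?thesis
    unfolding trop_dist_def D_def[symmetric] s_def[symmetric] by simp
qed

lemma proj_dist_eq:
  assumes "d \<ge> 3"
  shows "proj_dist d \<mu>1 \<mu>2 e0 e \<omega> =
    (MAX i\<in>{1..d}. e i \<omega> + e0 \<omega> * of_bool (i \<le> 2) -
       second_smallest d (\<lambda>k. e k \<omega> + e0 \<omega> * of_bool (k \<le> 2)))"
proof -
  have y: "sample_point \<mu>1 \<mu>2 e0 e \<omega> i - line_offset \<mu>1 \<mu>2 i = e i \<omega> + e0 \<omega> * of_bool (i \<le> 2)"
    if "i \<in> {1..d}" for i
  proof -
    have "i = 1 \<or> i = 2 \<or> i > 2" using that by auto
    then show ?thesis by (auto simp: sample_point_def line_offset_def)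
  qed
  then have "second_smallest d (\<lambda>i. sample_point \<mu>1 \<mu>2 e0 e \<omega> i - line_offset \<mu>1 \<mu>2 i) =
      second_smallest d (\<lambda>k. e k \<omega> + e0 \<omega> * of_bool (k \<le> 2))"
    by (rule second_smallest_cong)
  with y show ?thesis
    unfolding proj_dist_def trop_dist_projected_point[OF assms] by (simp cong: image_cong_simp)
qed

lemma proj_dist_nonneg:
  assumes "d \<ge> 1"
  shows "0 \<le> proj_dist d \<mu>1 \<mu>2 e0 e \<omega>"
proof -
  have "Min (f ` {1..d}) \<le> Max (f ` {1..d})" for f :: "nat \<Rightarrow> real"
    using assms by (intro order_trans[OF Min_le[of _ "f 1"] Max_ge]) auto
  then show ?thesis by (simp add: proj_dist_def trop_dist_def)
qed

text \<open>
  The second smallest value is one of the entries, say at \<open>b\<close>. In the difference of the entries at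
  \<open>i\<close> and \<open>b\<close> the common error either cancels or occurs once with some sign.
\<close>

lemma proj_dist_le:
  assumes "d \<ge> 3"
  shows "proj_dist d \<mu>1 \<mu>2 e0 e \<omega> \<le>
    (MAX i\<in>{1..d}. e i \<omega>) + (MAX i\<in>{1..d}. - e i \<omega>) + \<bar>e0 \<omega>\<bar>"
proof -
  define y where "y i = e i \<omega> + e0 \<omega> * of_bool (i \<le> 2)" for i
  have d1: "d \<ge> 1" and d2: "d \<ge> 2" using assms by simp_all
  obtain a where a: "a \<in> {1..d}" "\<And>j. j \<in> {1..d} \<Longrightarrow> y a \<le> y j"
    using exists_minimizer[OF d1, of y] by blast
  obtain b where b: "b \<in> {1..d}" "second_smallest d y = y b"
    using second_smallest_eq_min_without[of d a y, OF d2 a] min_without_attained[OF d2] by metis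
  have "y i - y b \<le> (MAX i\<in>{1..d}. e i \<omega>) + (MAX i\<in>{1..d}. - e i \<omega>) + \<bar>e0 \<omega>\<bar>"
    if "i \<in> {1..d}" for i
  proof -
    have "e i \<omega> \<le> (MAX i\<in>{1..d}. e i \<omega>)" "- e b \<omega> \<le> (MAX i\<in>{1..d}. - e i \<omega>)"
      using that b(1) by (auto intro!: Max_ge)
    then show ?thesis by (auto simp: y_def of_bool_def)
  qed
  then show ?thesis
    unfolding proj_dist_eq[OF assms] y_def[symmetric] b(2)
    using d1 by (subst Max_le_iff) auto
qed

section \<open>Maxima of normal variables\<close>

text \<open>
  Completing the square turns the density multiplied by \<open>exp (t * x)\<close> into the density with
  mean \<open>t * \<sigma>\<^sup>2\<close>, up to a constant factor.
\<close>

lemma normal_density_mult_exp: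
  assumes "\<sigma> > 0"
  shows "normal_density 0 \<sigma> x * exp (t * x) =
    exp (t\<^sup>2 * \<sigma>\<^sup>2 / 2) * normal_density (t * \<sigma>\<^sup>2) \<sigma> x"
proof -
  have "- (x - 0)\<^sup>2 / (2 * \<sigma>\<^sup>2) + t * x = t\<^sup>2 * \<sigma>\<^sup>2 / 2 + - (x - t * \<sigma>\<^sup>2)\<^sup>2 / (2 * \<sigma>\<^sup>2)"
    using assms by (simp add: field_simps power2_eq_square)
  then have "exp (- (x - 0)\<^sup>2 / (2 * \<sigma>\<^sup>2)) * exp (t * x) =
      exp (t\<^sup>2 * \<sigma>\<^sup>2 / 2) * exp (- (x - t * \<sigma>\<^sup>2)\<^sup>2 / (2 * \<sigma>\<^sup>2))"
    by (simp only: flip: exp_add)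
  then show ?thesis by (simp add: normal_density_def)
qed

context prob_space
begin

lemma normal_exp_moment:
  assumes "\<sigma> > 0" and X: "distributed M lborel X (normal_density 0 \<sigma>)"
  shows "integrable M (\<lambda>\<omega>. exp (t * X \<omega>))"
    and "expectation (\<lambda>\<omega>. exp (t * X \<omega>)) = exp (t\<^sup>2 * \<sigma>\<^sup>2 / 2)"
proof -
  have "integrable lborel (\<lambda>x. normal_density 0 \<sigma> x * exp (t * x))"
    unfolding normal_density_mult_exp[OF assms(1)]
    using integrable_normal_density[OF assms(1)] by simp
  then show "integrable M (\<lambda>\<omega>. exp (t * X \<omega>))"
    using distributed_integrable[OF X, of "\<lambda>x. exp (t * x)"] by simp
  have "expectation (\<lambda>\<omega>. exp (t * X \<omega>)) = (\<integral>x. normal_density 0 \<sigma> x * exp (t * x) \<partial>lborel)"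
    using distributed_integral[OF X, of "\<lambda>x. exp (t * x)"] by simp
  then show "expectation (\<lambda>\<omega>. exp (t * X \<omega>)) = exp (t\<^sup>2 * \<sigma>\<^sup>2 / 2)"
    unfolding normal_density_mult_exp[OF assms(1)]
    using integral_normal_density[OF assms(1)] by simp
qed

lemma normal_integrable:
  assumes "\<sigma> > 0" and "distributed M lborel X (normal_density 0 \<sigma>)"
  shows "integrable M X"
  using distributed_integrable_var[OF assms(2)] integrable_normal_moment_nz_1[OF assms(1)] by simp

lemma normal_uminus:
  assumes "\<sigma> > 0" and "distributed M lborel X (normal_density 0 \<sigma>)"
  shows "distributed M lborel (\<lambda>\<omega>. - X \<omega>) (normal_density 0 \<sigma>)"
  using normal_density_affine[OF assms(2,1), of "-1" 0] by simp

lemma integrable_Max: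
  fixes X :: "'i \<Rightarrow> 'a \<Rightarrow> real"
  assumes "finite I" "I \<noteq> {}" "\<And>i. i \<in> I \<Longrightarrow> integrable M (X i)"
  shows "integrable M (\<lambda>\<omega>. MAX i\<in>I. X i \<omega>)"
proof -
  have "integrable M (\<lambda>\<omega>. \<Sum>i\<in>I. \<bar>X i \<omega>\<bar>)"
    using assms(3) by auto
  then show ?thesis
  proof (rule Bochner_Integration.integrable_bound)
    show "(\<lambda>\<omega>. MAX i\<in>I. X i \<omega>) \<in> borel_measurable M"
      using assms by (intro borel_measurable_Max) auto
    have "\<bar>MAX i\<in>I. X i \<omega>\<bar> \<le> (\<Sum>i\<in>I. \<bar>X i \<omega>\<bar>)" for \<omega>
    proof -
      have "(MAX i\<in>I. X i \<omega>) \<in> (\<lambda>i. X i \<omega>) ` I"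
        using assms(1,2) by (intro Max_in) auto
      then obtain k where "k \<in> I" "(MAX i\<in>I. X i \<omega>) = X k \<omega>"
        by blast
      then show ?thesis
        using assms(1) member_le_sum[of k I "\<lambda>i. \<bar>X i \<omega>\<bar>"] by simp
    qed
    then show "AE \<omega> in M. norm (MAX i\<in>I. X i \<omega>) \<le> norm (\<Sum>i\<in>I. \<bar>X i \<omega>\<bar>)"
      by (intro AE_I2) (simp add: abs_of_nonneg[OF sum_nonneg])
  qed
qed

text \<open>
  For \<open>t > 0\<close> the exponential of \<open>t\<close> times the maximum is at most the sum of the exponentials,
  so its expectation is at most \<open>n exp (t\<^sup>2 \<sigma>\<^sup>2 / 2) = exp c\<close> with
  \<open>c = ln n + t\<^sup>2 \<sigma>\<^sup>2 / 2\<close>. Bounding the exponential below by its tangent at \<open>c\<close> yields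
  \<open>t E max \<le> c\<close>, and \<open>t = sqrt (2 ln n) / \<sigma>\<close> makes \<open>c / t\<close> smallest.
\<close>

lemma expectation_Max_normal_le:
  fixes X :: "'i \<Rightarrow> 'a \<Rightarrow> real"
  assumes "\<sigma> > 0" and I: "finite I" "card I \<ge> 2"
    and X: "\<And>i. i \<in> I \<Longrightarrow> distributed M lborel (X i) (normal_density 0 \<sigma>)"
  shows "expectation (\<lambda>\<omega>. MAX i\<in>I. X i \<omega>) \<le> \<sigma> * sqrt (2 * ln (card I))"
proof -
  define n where "n = real (card I)"
  define r where "r = sqrt (2 * ln n)"
  define t where "t = r / \<sigma>"
  define c where "c = ln n + t\<^sup>2 * \<sigma>\<^sup>2 / 2"
  have n: "n > 1" using I(2) by (simp add: n_def)
  then have r: "r > 0" "r\<^sup>2 = 2 * ln n" by (simp_all add: r_def)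
  have t: "t > 0" using r(1) assms(1) by (simp add: t_def)
  have "t * \<sigma> = r" using assms(1) by (simp add: t_def)
  then have c: "c = r\<^sup>2" using r(2) by (simp add: c_def flip: power_mult_distrib)
  have ne: "I \<noteq> {}" using I by auto
  let ?Y = "\<lambda>\<omega>. MAX i\<in>I. X i \<omega>"
  have intY: "integrable M ?Y"
    using I(1) ne normal_integrable[OF assms(1) X] by (rule integrable_Max)
  have intE: "integrable M (\<lambda>\<omega>. \<Sum>i\<in>I. exp (t * X i \<omega>))"
    using normal_exp_moment(1)[OF assms(1) X] by auto
  have point: "t * ?Y \<omega> \<le> c - 1 + (\<Sum>i\<in>I. exp (t * X i \<omega>)) * exp (- c)" for \<omega>
  proof -
    have "?Y \<omega> \<in> (\<lambda>i. X i \<omega>) ` I" using I(1) ne by (intro Max_in) auto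
    then obtain k where k: "k \<in> I" "?Y \<omega> = X k \<omega>" by blast
    have "1 + (t * X k \<omega> - c) \<le> exp (t * X k \<omega>) * exp (- c)"
      using exp_ge_add_one_self[of "t * X k \<omega> - c"] by (simp flip: exp_add)
    also have "\<dots> \<le> (\<Sum>i\<in>I. exp (t * X i \<omega>)) * exp (- c)"
      using member_le_sum[of k I "\<lambda>i. exp (t * X i \<omega>)"] k(1) I(1)
      by (intro mult_right_mono) auto
    finally show ?thesis using k(2) by simp
  qed
  have "t * expectation ?Y = expectation (\<lambda>\<omega>. t * ?Y \<omega>)" by simp
  also have "\<dots> \<le> expectation (\<lambda>\<omega>. c - 1 + (\<Sum>i\<in>I. exp (t * X i \<omega>)) * exp (- c))"
    using intY intE point by (intro integral_mono) auto
  also have "\<dots> = c - 1 + expectation (\<lambda>\<omega>. \<Sum>i\<in>I. exp (t * X i \<omega>)) * exp (- c)"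
    using intE by (simp add: prob_space)
  also have "expectation (\<lambda>\<omega>. \<Sum>i\<in>I. exp (t * X i \<omega>)) = n * exp (t\<^sup>2 * \<sigma>\<^sup>2 / 2)"
    using normal_exp_moment[OF assms(1) X]
    by (subst Bochner_Integration.integral_sum) (simp_all add: n_def)
  also have "n * exp (t\<^sup>2 * \<sigma>\<^sup>2 / 2) = exp c"
    using n by (simp add: c_def exp_add)
  finally have "t * expectation ?Y \<le> t * (\<sigma> * r)"
    using \<open>t * \<sigma> = r\<close> by (simp add: c power2_eq_square flip: exp_add mult.assoc)
  then show ?thesis using t by (simp add: r_def n_def)
qed

end

section \<open>The expected distance\<close>

lemma proj_dist_integrable_expectation_le:
  assumes "d \<ge> 3" "\<sigma> > 0" "gaussian_noise d \<sigma> M e0 e"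
  shows "integrable M (proj_dist d \<mu>1 \<mu>2 e0 e)"
    and "prob_space.expectation M (proj_dist d \<mu>1 \<mu>2 e0 e) \<le> 3 * \<sigma> * sqrt (2 * ln (real d))"
proof -
  interpret prob_space M using assms(3) by (simp add: gaussian_noise_def)
  have e0: "distributed M lborel e0 (normal_density 0 \<sigma>)"
    and e: "\<And>i. i \<in> {1..d} \<Longrightarrow> distributed M lborel (e i) (normal_density 0 \<sigma>)"
    using assms(3) by (auto simp: gaussian_noise_def)
  note me = normal_uminus[OF assms(2) e]
  have d2: "d \<ge> 2" and ne: "{1..d} \<noteq> {}" using assms(1) by simp_all
  define P N A where "P = (\<lambda>\<omega>. MAX i\<in>{1..d}. e i \<omega>)" and "N = (\<lambda>\<omega>. MAX i\<in>{1..d}. - e i \<omega>)"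
    and "A = (\<lambda>\<omega>. \<bar>e0 \<omega>\<bar>)"
  have int: "integrable M P" "integrable M N" "integrable M A"
    unfolding P_def N_def A_def
    using integrable_Max[OF _ ne, of e] integrable_Max[OF _ ne, of "\<lambda>i \<omega>. - e i \<omega>"]
      normal_integrable[OF assms(2)] e e0 by auto
  have le: "proj_dist d \<mu>1 \<mu>2 e0 e \<omega> \<le> P \<omega> + N \<omega> + A \<omega>" for \<omega>
    using proj_dist_le[OF assms(1)] by (simp add: P_def N_def A_def)
  have meas [measurable]: "e0 \<in> borel_measurable M" "\<And>i. i \<in> {1..d} \<Longrightarrow> e i \<in> borel_measurable M"
    using normal_integrable[OF assms(2)] e e0 by auto
  have ybor: "(\<lambda>\<omega>. e i \<omega> + e0 \<omega> * of_bool (i \<le> 2)) \<in> borel_measurable M" if "i \<in> {1..d}" for i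
    using that by measurable
  have proj_bor: "proj_dist d \<mu>1 \<mu>2 e0 e \<in> borel_measurable M"
    unfolding proj_dist_eq[OF assms(1), abs_def] second_smallest_eq_Max_min_without[OF d2]
      min_without_def
    by (intro borel_measurable_Max borel_measurable_Min borel_measurable_diff ybor) auto
  show int_proj: "integrable M (proj_dist d \<mu>1 \<mu>2 e0 e)"
  proof (rule Bochner_Integration.integrable_bound[OF _ proj_bor])
    show "integrable M (\<lambda>\<omega>. P \<omega> + N \<omega> + A \<omega>)" using int by auto
    show "AE \<omega> in M. norm (proj_dist d \<mu>1 \<mu>2 e0 e \<omega>) \<le> norm (P \<omega> + N \<omega> + A \<omega>)"
      using proj_dist_nonneg[of d \<mu>1 \<mu>2 e0 e] assms(1) order_trans[OF le abs_ge_self] by auto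
  qed
  have P: "expectation P \<le> \<sigma> * sqrt (2 * ln (real d))"
    using expectation_Max_normal_le[of \<sigma> "{1..d}" e, OF assms(2) _ _ e] d2 by (simp add: P_def)
  have N: "expectation N \<le> \<sigma> * sqrt (2 * ln (real d))"
    using expectation_Max_normal_le[of \<sigma> "{1..d}" "\<lambda>i \<omega>. - e i \<omega>", OF assms(2) _ _ me] d2 by (simp add: N_def)
  \<comment> \<open>The absolute value is the maximum of two normal variables, indexed by the truth values.\<close>
  have "A = (\<lambda>\<omega>. MAX b\<in>UNIV. if b then e0 \<omega> else - e0 \<omega>)"
    by (auto simp: A_def UNIV_bool abs_if)
  moreover have "expectation (\<lambda>\<omega>. MAX b\<in>UNIV. (if b then e0 else (\<lambda>\<omega>. - e0 \<omega>)) \<omega>)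
      \<le> \<sigma> * sqrt (2 * ln (card (UNIV :: bool set)))"
    using e0 normal_uminus[OF assms(2) e0] by (intro expectation_Max_normal_le assms(2)) auto
  ultimately have "expectation A \<le> \<sigma> * sqrt (2 * ln 2)"
    by (simp add: if_distrib[of "\<lambda>f. f _"] cong: if_cong)
  also have "\<dots> \<le> \<sigma> * sqrt (2 * ln (real d))"
    using assms(2) d2 by simp
  finally have A: "expectation A \<le> \<sigma> * sqrt (2 * ln (real d))" .
  have "expectation (proj_dist d \<mu>1 \<mu>2 e0 e) \<le> expectation (\<lambda>\<omega>. P \<omega> + N \<omega> + A \<omega>)"
    using int_proj int le by (intro integral_mono) auto
  also have "\<dots> = expectation P + expectation N + expectation A"
    using int by simp
  finally show "expectation (proj_dist d \<mu>1 \<mu>2 e0 e) \<le> 3 * \<sigma> * sqrt (2 * ln (real d))"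
    using P N A by simp
qed

lemma tendsto_expectation_proj_dist:
  assumes "d \<ge> 3" and noise: "\<And>s. s > 0 \<Longrightarrow> gaussian_noise d s (N s) (f0 s) (f s)"
  shows "((\<lambda>s. prob_space.expectation (N s) (proj_dist d \<mu>1 \<mu>2 (f0 s) (f s))) \<longlongrightarrow> 0)
    (at_right 0)"
proof (rule tendsto_sandwich)
  show "\<forall>\<^sub>F s in at_right 0. 0 \<le> prob_space.expectation (N s) (proj_dist d \<mu>1 \<mu>2 (f0 s) (f s))"
    using assms(1) by (intro always_eventually allI Bochner_Integration.integral_nonneg proj_dist_nonneg) simp
  show "\<forall>\<^sub>F s in at_right 0. prob_space.expectation (N s) (proj_dist d \<mu>1 \<mu>2 (f0 s) (f s))
      \<le> 3 * s * sqrt (2 * ln (real d))"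
    using eventually_at_right_less[of "0::real"]
    by eventually_elim (rule proj_dist_integrable_expectation_le(2)[OF assms(1) _ noise])
  show "((\<lambda>s. 3 * s * sqrt (2 * ln (real d))) \<longlongrightarrow> 0) (at_right 0)"
    by (auto intro!: tendsto_eq_intros)
qed auto

theorem theorem12:
  fixes d :: nat and \<sigma> \<mu>1 \<mu>2 :: real
    and M :: "'a measure" and e0 :: "'a \<Rightarrow> real" and e :: "nat \<Rightarrow> 'a \<Rightarrow> real"
  assumes "d \<ge> 3" and "\<sigma> > 0" and "gaussian_noise d \<sigma> M e0 e"
  shows "(\<forall>\<omega>\<in>space M.
            proj_dist d \<mu>1 \<mu>2 e0 e \<omega> =
            (MAX i\<in>{1..d}. e i \<omega> + e0 \<omega> * of_bool (i \<le> 2) -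
               second_smallest d (\<lambda>k. e k \<omega> + e0 \<omega> * of_bool (k \<le> 2))))
       \<and> integrable M (proj_dist d \<mu>1 \<mu>2 e0 e)
       \<and> prob_space.expectation M (proj_dist d \<mu>1 \<mu>2 e0 e) \<le> 3 * \<sigma> * sqrt (2 * ln (real d))
       \<and> (\<forall>(N :: real \<Rightarrow> 'b measure) f0 f.
            (\<forall>s>0. gaussian_noise d s (N s) (f0 s) (f s)) \<longrightarrow>
            ((\<lambda>s. prob_space.expectation (N s) (proj_dist d \<mu>1 \<mu>2 (f0 s) (f s))) \<longlongrightarrow> 0)
              (at_right 0))"
  by (intro conjI ballI allI impI proj_dist_eq[OF assms(1)] proj_dist_integrable_expectation_le[OF assms]
      tendsto_expectation_proj_dist[OF assms(1)]) simp

end
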